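(* Let $N$ be a nonnegative integer-valued random variable and let $X_1,X_2,\ldots$ be a sequence of independent and identically distributed nonnegative random variables with mean $\mu=\mathrm{E}[X_1]>0$. Let $S_0=0$, $S_n=X_1+\cdots+X_n$ for $n\ge 1$, and $S_N=\sum_{i=1}^N X_i$. Suppose that $N$ and $\{X_i\}_{i\ge 1}$ are independent, that $\mathrm{E}[e^{\gamma X_1}]<\infty$ for some $\gamma>0$, and that there is a positive function $a$, defined in a neighbourhood of infinity, such that $$\lim_{x\to\infty}\frac{\Pr[N>x+y\,a(x)]}{\Pr[N>x]}=e^{-y}\qquad\text{for every } y\in\mathbb R,$$ and $$\liminf_{x\to\infty}\frac{\log a(x)}{\log x}>\frac12.$$ Then $$\Pr[S_N>x]\sim \Pr[N>x/\mu],\qquad x\to\infty.$$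
   Context: The first displayed condition on $N$ (membership of the Gumbel max-domain of attraction with auxiliary function $a$) includes that $\Pr[N>x]>0$ for all $x$. For positive functions $f,g$ defined in a neighbourhood of infinity, $f(x)\sim g(x)$ as $x\to\infty$ means $f(x)/g(x)\to 1$. *)

theory Defs
  imports "HOL-Probability.Probability" "HOL-Library.Landau_Symbols"
begin

definition iid_seq :: "'a measure \<Rightarrow> (nat \<Rightarrow> 'a \<Rightarrow> real) \<Rightarrow> bool" where
  "iid_seq M X \<longleftrightarrow>
     prob_space.indep_vars M (\<lambda>_. borel) X {1..} \<and>
     (\<forall>i\<ge>1. distr M borel (X i) = distr M borel (X 1))"

text \<open>Independence of \<open>N\<close> from the whole sequence, the sequence being regarded as one random
  element of the product space over the index set \<open>{1..}\<close>. It is expressed through the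
  generated sigma-algebras because the library's \<open>indep_var\<close> needs both random variables
  to have the same value type.\<close>

definition indep_of_seq :: "'a measure \<Rightarrow> ('a \<Rightarrow> nat) \<Rightarrow> (nat \<Rightarrow> 'a \<Rightarrow> real) \<Rightarrow> bool" where
  "indep_of_seq M N X \<longleftrightarrow>
     prob_space.indep_set M
       (sets (vimage_algebra (space M) N (count_space UNIV)))
       (sets (vimage_algebra (space M) (\<lambda>\<omega>. \<lambda>i\<in>{1..}. X i \<omega>) (\<Pi>\<^sub>M i\<in>{1..}. borel)))"

definition partial_sum :: "(nat \<Rightarrow> 'a \<Rightarrow> real) \<Rightarrow> nat \<Rightarrow> 'a \<Rightarrow> real" where
  "partial_sum X n \<omega> = (\<Sum>i=1..n. X i \<omega>)"

definition tail_prob :: "'a measure \<Rightarrow> ('a \<Rightarrow> real) \<Rightarrow> real \<Rightarrow> real" where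
  "tail_prob M Y x = measure M {\<omega> \<in> space M. Y \<omega> > x}"

text \<open>Membership of the Gumbel max-domain of attraction with auxiliary function \<open>a\<close>. As \<open>a\<close>
  need only be given in a neighbourhood of infinity, it is a total function of which only
  the values at large arguments are constrained. The right endpoint is required to be
  infinite.\<close>

definition gumbel_mda :: "'a measure \<Rightarrow> ('a \<Rightarrow> real) \<Rightarrow> (real \<Rightarrow> real) \<Rightarrow> bool" where
  "gumbel_mda M Y a \<longleftrightarrow>
     (\<forall>\<^sub>F x in at_top. a x > 0) \<and>
     (\<forall>x. tail_prob M Y x > 0) \<and>
     (\<forall>y. ((\<lambda>x. tail_prob M Y (x + y * a x) / tail_prob M Y x) \<longlongrightarrow> exp (- y)) at_top)"

end

theory Submission
  imports Defs "HOL-Real_Asymp.Real_Asymp"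
begin

text \<open>
  Write \<open>G\<close> for the tail of \<open>N\<close> and \<open>w = x / \<mu>\<close>. Up to the factors \<open>exp (\<plusminus>\<epsilon>)\<close> produced by
  moving \<open>w\<close> to \<open>w \<plusminus> \<epsilon> a(w)\<close>, the event \<open>S\<^sub>N > x\<close> is the event \<open>N > w\<close>: by the Chernoff bound with
  parameter \<open>\<theta> = 1 / sqrt w\<close>, the sum \<open>S\<^sub>n\<close> lies on the wrong side of \<open>x\<close> with probability at most
  \<open>exp (C - k |n - w| / sqrt w)\<close>. For \<open>n\<close> below \<open>w - \<epsilon> a(w)\<close> this has to be small compared with
  \<open>G w\<close>. As \<open>a(w) / sqrt w\<close> tends to infinity, \<open>G z \<le> K exp (c (w - z) / sqrt w) G w\<close> for all \<open>z \<le> w\<close>,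
  with \<open>c > 0\<close> as small as desired, so half of the Chernoff exponent absorbs the growth of
  \<open>P(N = n) / G w\<close>. The other half makes each of the at most \<open>w + 1\<close> terms smaller than any power
  of \<open>w\<close>, because \<open>a(w) / sqrt w\<close> grows like a power of \<open>w\<close>.
\<close>

section \<open>Growth of the tail of \<open>N\<close> to the left, on the scale of a square
  root\<close>

text \<open>In the variable \<open>u = sqrt z\<close>, a step of fixed length \<open>d\<close> costs at most the factor
  \<open>exp 2\<close>, since \<open>(u + d)\<^sup>2 \<le> u\<^sup>2 + a(u\<^sup>2)\<close> for large \<open>u\<close>.\<close>

lemma tail_ratio_bound:
  fixes G a :: "real \<Rightarrow> real"
  assumes "antimono G" and pos: "\<And>x. 0 < G x" and le1: "\<And>x. G x \<le> 1"
    and lim: "((\<lambda>x. G (x + a x) / G x) \<longlongrightarrow> exp (- 1)) at_top"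
    and a: "filterlim (\<lambda>x. a x / sqrt x) at_top at_top"
    and "c > 0"
  obtains K where "K > 0"
    "\<And>z w. 0 < w \<Longrightarrow> z \<le> w \<Longrightarrow> G z \<le> K * exp (c * (w - z) / sqrt w) * G w"
proof -
  note mono = antimonoD[OF \<open>antimono G\<close>]
  have nonneg: "0 \<le> G x" for x using pos[of x] by simp
  \<comment> \<open>A step of length \<open>d\<close> will cost a factor \<open>exp 2\<close>, so
    this choice makes the exponential rate in the variable \<open>u\<close> equal to
    \<open>2 / d = c\<close>.\<close>
  define d where "d = 2 / c"
  have "d > 0" using \<open>c > 0\<close> by (simp add: d_def)
  have "\<forall>\<^sub>F x in at_top. exp (- 2) < G (x + a x) / G x"
    by (rule order_tendstoD(1)[OF lim]) simp
  moreover have "\<forall>\<^sub>F x in at_top. 3 * d \<le> a x / sqrt x"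
    using a by (auto simp: filterlim_at_top)
  ultimately have "\<forall>\<^sub>F x in at_top. exp (- 2) < G (x + a x) / G x \<and> 3 * d \<le> a x / sqrt x"
    by eventually_elim auto
  then obtain x0 where x0: "\<And>x. x \<ge> x0 \<Longrightarrow> exp (- 2) < G (x + a x) / G x"
      "\<And>x. x \<ge> x0 \<Longrightarrow> 3 * d \<le> a x / sqrt x"
    by (auto simp: eventually_at_top_linorder)
  \<comment> \<open>\<open>u0 >= 1\<close> gives u * u >= u >= \<open>x0\<close>, so the eventual
    bounds apply at the square; \<open>u0 >= d\<close> lets d * d be absorbed into d * u.\<close>
  define u0 where "u0 = max 1 (max d x0)"
  have u0: "u0 \<ge> 1" "u0 \<ge> d" "u0 \<ge> x0" by (auto simp: u0_def)
  have step: "G (u\<^sup>2) \<le> exp 2 * G ((u + d)\<^sup>2)" if "u \<ge> u0" for u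
  proof -
    have u: "u \<ge> 1" "u \<ge> d" "u \<ge> x0" using that u0 by auto
    have "u * 1 \<le> u * u" using u by (intro mult_left_mono) auto
    then have sq: "u\<^sup>2 \<ge> x0" using u unfolding power2_eq_square by linarith
    \<comment> \<open>Expanding the square of \<open>u + d\<close> adds 2 * d * u + d * d, which is
      at most 3 * d * u. This is where the constant 3 comes from.\<close>
    have "3 * d * u \<le> a (u\<^sup>2)" using x0(2)[OF sq] u by (simp add: field_simps)
    moreover have "d * d \<le> d * u" using u \<open>d > 0\<close> by simp
    ultimately have "(u + d)\<^sup>2 \<le> u\<^sup>2 + a (u\<^sup>2)" by (simp add: power2_eq_square algebra_simps)
    from mono[OF this] have "exp (- 2) * G (u\<^sup>2) \<le> G ((u + d)\<^sup>2)"
      using x0(1)[OF sq] pos[of "u\<^sup>2"] by (simp add: field_simps)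
    then show ?thesis by (simp add: exp_minus field_simps)
  qed
  have iter: "G (u\<^sup>2) \<le> exp (2 * real k) * G ((u + real k * d)\<^sup>2)" if "u \<ge> u0" for u k
  proof (induction k)
    case (Suc k)
    have "u0 \<le> u + real k * d" using that \<open>d > 0\<close> by (simp add: add_increasing2)
    from step[OF this] have "exp (2 * real k) * G ((u + real k * d)\<^sup>2)
       \<le> exp (2 * real k) * (exp 2 * G ((u + real k * d + d)\<^sup>2))" by simp
    also have "\<dots> = exp (2 * real (Suc k)) * G ((u + real (Suc k) * d)\<^sup>2)"
      by (simp add: algebra_simps flip: exp_add)
    finally show ?case using Suc by linarith
  qed simp
  have main: "G (u\<^sup>2) \<le> exp 2 * exp (c * (v - u)) * G (v\<^sup>2)" if "u0 \<le> u" "u \<le> v" for u v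
  proof -
    \<comment> \<open>Rounding the number of steps up overshoots \<open>v\<close> by less than one
      step; the overshoot is paid for by the extra factor \<open>exp 2\<close>.\<close>
    define k where "k = nat \<lceil>(v - u) / d\<rceil>"
    have "(v - u) / d \<ge> 0" using that \<open>d > 0\<close> by simp
    then have k: "(v - u) / d \<le> real k" "real k \<le> (v - u) / d + 1"
      unfolding k_def by linarith+
    have "v \<le> u + real k * d" using k(1) \<open>d > 0\<close> by (simp add: field_simps)
    then have "v\<^sup>2 \<le> (u + real k * d)\<^sup>2" using that u0 by (intro power_mono) auto
    then have "G (u\<^sup>2) \<le> exp (2 * real k) * G (v\<^sup>2)"
      using iter[OF that(1), of k] mono
      by (meson exp_ge_zero mult_left_mono order_trans)
    also have "\<dots> \<le> exp (2 + c * (v - u)) * G (v\<^sup>2)"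
    proof (intro mult_right_mono)
      have "2 * ((v - u) / d) = c * (v - u)" by (simp add: d_def)
      then have "2 * real k \<le> 2 + c * (v - u)" using k(2) by linarith
      then show "exp (2 * real k) \<le> exp (2 + c * (v - u))" by simp
    qed (use nonneg in auto)
    finally show ?thesis by (simp add: exp_add)
  qed
  \<comment> \<open>The division pays for arguments below the square of \<open>u0\<close>, where
    only \<open>G <= 1\<close> is known; \<open>exp 2\<close> is the constant from
    \<open>main\<close>.\<close>
  let ?K = "exp 2 / G (u0\<^sup>2)"
  have K1: "?K * G (u0\<^sup>2) \<ge> 1" using pos[of "u0\<^sup>2"] by simp
  show thesis
  proof
    show "?K > 0" using pos by simp
    fix z w :: real assume w: "0 < w" "z \<le> w"
    have e: "1 \<le> exp (c * (w - z) / sqrt w)" using w \<open>c > 0\<close> by simp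
    consider "w < u0\<^sup>2" | "z < u0\<^sup>2" "u0\<^sup>2 \<le> w" | "u0\<^sup>2 \<le> z" by linarith
    then show "G z \<le> ?K * exp (c * (w - z) / sqrt w) * G w"
    proof cases
      case 1
      have "G z \<le> 1 * 1" using le1 by simp
      also have "\<dots> \<le> (?K * G w) * exp (c * (w - z) / sqrt w)"
      proof (intro mult_mono e)
        have "?K * G (u0\<^sup>2) \<le> ?K * G w" using mono[of w "u0\<^sup>2"] 1 \<open>?K > 0\<close> by (intro mult_left_mono) auto
        then show "1 \<le> ?K * G w" using K1 by linarith
      qed (use nonneg \<open>?K > 0\<close> in auto)
      finally show ?thesis by (simp add: algebra_simps)
    next
      case 2
      have s: "u0 \<le> sqrt w" using 2 u0 by (simp add: real_le_rsqrt)
      have "G z \<le> 1" by (rule le1)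
      also have "1 = G (u0\<^sup>2) / G (u0\<^sup>2)" using pos[of "u0\<^sup>2"] by simp
      also have "\<dots> \<le> (exp 2 * exp (c * (sqrt w - u0)) * G ((sqrt w)\<^sup>2)) / G (u0\<^sup>2)"
        by (intro divide_right_mono main) (use s nonneg in auto)
      also have "\<dots> = ?K * exp (c * (sqrt w - u0)) * G w" using w by simp
      also have "\<dots> \<le> ?K * exp (c * ((w - z) / sqrt w)) * G w"
      proof (intro mult_right_mono mult_left_mono)
        \<comment> \<open>Return from square roots to the original variable: (sqrt w - u0) * sqrt w
          = w - u0 * sqrt w <= w - u0 * u0 <= w - z.\<close>
        have "u0 * u0 \<le> u0 * sqrt w" using s u0 by (intro mult_left_mono) auto
        then have "(sqrt w - u0) * sqrt w \<le> w - z"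
          using w 2 by (simp add: algebra_simps power2_eq_square)
        then have "sqrt w - u0 \<le> (w - z) / sqrt w" using w by (simp add: field_simps)
        from mult_left_mono[OF this, of c] show "exp (c * (sqrt w - u0)) \<le> exp (c * ((w - z) / sqrt w))"
          using \<open>c > 0\<close> by simp
      qed (use nonneg \<open>?K > 0\<close> in auto)
      finally show ?thesis by simp
    next
      case 3
      have z: "z > 0" using 3 u0 by (smt (verit) zero_less_power)
      have s: "u0 \<le> sqrt z" using 3 u0 by (simp add: real_le_rsqrt)
      have "G ((sqrt z)\<^sup>2) \<le> exp 2 * exp (c * (sqrt w - sqrt z)) * G ((sqrt w)\<^sup>2)"
        by (intro main s) (use w in auto)
      then have "G z \<le> exp 2 * exp (c * (sqrt w - sqrt z)) * G w" using w z by simp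
      also have "\<dots> \<le> ?K * exp (c * ((w - z) / sqrt w)) * G w"
      proof (intro mult_right_mono mult_mono)
        show "exp 2 \<le> ?K" using le1[of "u0\<^sup>2"] pos[of "u0\<^sup>2"] by (simp add: field_simps)
        have "sqrt z * sqrt z \<le> sqrt z * sqrt w" using w z by (intro mult_left_mono) auto
        then have "(sqrt w - sqrt z) * sqrt w \<le> w - z"
          using w z by (simp add: algebra_simps)
        then have "sqrt w - sqrt z \<le> (w - z) / sqrt w" using w by (simp add: field_simps)
        from mult_left_mono[OF this, of c] show "exp (c * (sqrt w - sqrt z)) \<le> exp (c * ((w - z) / sqrt w))"
          using \<open>c > 0\<close> by simp
      qed (use nonneg \<open>?K > 0\<close> in auto)
      finally show ?thesis by simp
    qed
  qed
qed

section \<open>Exponential moments and Chernoff bounds for the partial sums\<close>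

text \<open>Taylor expansion to second order, with an intermediate point \<open>t\<close> of modulus
  at most s = \<gamma> * x / 2. One factor \<open>exp s\<close> bounds \<open>exp t\<close>, another
  bounds s * s / 2, and their product is \<open>exp (\<gamma> * x)\<close>. The remainder is thus
  integrable at x = \<open>X 1\<close>, for either sign of \<theta>.\<close>

lemma exp_mult_le_quadratic:
  fixes \<theta> \<gamma> x :: real
  assumes "\<gamma> > 0" "\<bar>\<theta>\<bar> \<le> \<gamma> / 2" "x \<ge> 0"
  shows "exp (\<theta> * x) \<le> 1 + \<theta> * x + \<theta>\<^sup>2 * (4 / \<gamma>\<^sup>2 * exp (\<gamma> * x))"
proof -
  define s where "s = \<gamma> / 2 * x"
  have "s \<ge> 0" using assms by (simp add: s_def)
  obtain t where t: "\<bar>t\<bar> \<le> \<bar>\<theta> * x\<bar>" "exp (\<theta> * x) = 1 + \<theta> * x + exp t / 2 * (\<theta> * x)\<^sup>2"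
    using Maclaurin_exp_le[of "\<theta> * x" 2] by (auto simp: numeral_2_eq_2 lessThan_Suc)
  have "\<bar>\<theta> * x\<bar> \<le> s"
    using mult_right_mono[OF assms(2,3)] assms(3) by (simp add: s_def abs_mult)
  with t have "exp t \<le> exp s" by simp
  have "s\<^sup>2 / 2 \<le> exp s" using exp_lower_Taylor_quadratic[OF \<open>s \<ge> 0\<close>] \<open>s \<ge> 0\<close> by linarith
  have "exp t / 2 * x\<^sup>2 = exp t * (4 / \<gamma>\<^sup>2 * (s\<^sup>2 / 2))"
    using assms by (simp add: s_def power_mult_distrib field_simps)
  also have "\<dots> \<le> exp s * (4 / \<gamma>\<^sup>2 * exp s)"
    by (intro mult_mono mult_left_mono \<open>exp t \<le> exp s\<close> \<open>s\<^sup>2 / 2 \<le> exp s\<close>) (use assms in auto)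
  also have "\<dots> = 4 / \<gamma>\<^sup>2 * exp (\<gamma> * x)" by (simp add: s_def mult.assoc flip: exp_add)
  finally have "\<theta>\<^sup>2 * (exp t / 2 * x\<^sup>2) \<le> \<theta>\<^sup>2 * (4 / \<gamma>\<^sup>2 * exp (\<gamma> * x))"
    by (intro mult_left_mono) auto
  with t(2) show ?thesis by (simp add: power_mult_distrib algebra_simps)
qed

locale light_tailed_walk = prob_space M for M :: "'a measure" +
  fixes X :: "nat \<Rightarrow> 'a \<Rightarrow> real" and \<gamma> :: real
  assumes measurable_X: "\<And>i. i \<ge> 1 \<Longrightarrow> X i \<in> borel_measurable M"
    and nonneg_X: "\<And>i \<omega>. i \<ge> 1 \<Longrightarrow> \<omega> \<in> space M \<Longrightarrow> X i \<omega> \<ge> 0"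
    and iid: "iid_seq M X"
    and gamma_pos: "\<gamma> > 0"
    and integrable_exp: "integrable M (\<lambda>\<omega>. exp (\<gamma> * X 1 \<omega>))"
begin

abbreviation "\<mu> \<equiv> expectation (X 1)"

lemma measurable_X1 [measurable]: "X 1 \<in> borel_measurable M" "X (Suc 0) \<in> borel_measurable M"
  using measurable_X[of 1] by auto

lemma measurable_partial_sum [measurable]: "partial_sum X n \<in> borel_measurable M"
  unfolding partial_sum_def[abs_def] by (intro borel_measurable_sum measurable_X) auto

lemma partial_sum_mono: "\<omega> \<in> space M \<Longrightarrow> m \<le> n \<Longrightarrow> partial_sum X m \<omega> \<le> partial_sum X n \<omega>"
  unfolding partial_sum_def by (intro sum_mono2 nonneg_X) auto

lemma integrable_exp_X1:
  assumes "\<theta> \<le> \<gamma>" shows "integrable M (\<lambda>\<omega>. exp (\<theta> * X 1 \<omega>))"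
  by (rule Bochner_Integration.integrable_bound[OF integrable_exp])
    (use assms nonneg_X[of 1] in \<open>auto intro!: AE_I2 mult_right_mono\<close>)

lemma integrable_X1: "integrable M (X 1)"
proof (rule Bochner_Integration.integrable_bound)
  show "integrable M (\<lambda>\<omega>. exp (\<gamma> * X 1 \<omega>) / \<gamma>)" using integrable_exp by simp
  show "AE \<omega> in M. norm (X 1 \<omega>) \<le> norm (exp (\<gamma> * X 1 \<omega>) / \<gamma>)"
  proof (rule AE_I2)
    fix \<omega> assume "\<omega> \<in> space M"
    then have "X 1 \<omega> \<ge> 0" using nonneg_X[of 1] by simp
    moreover have "\<gamma> * X 1 \<omega> \<le> exp (\<gamma> * X 1 \<omega>)" using exp_ge_add_one_self[of "\<gamma> * X 1 \<omega>"] by linarith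
    ultimately show "norm (X 1 \<omega>) \<le> norm (exp (\<gamma> * X 1 \<omega>) / \<gamma>)"
      using gamma_pos by (simp add: field_simps)
  qed
qed simp

text \<open>The expectation of the remainder in \<open>exp_mult_le_quadratic\<close>, stripped of
  the square of \<theta>. It does not depend on \<theta>, so \<theta> may later shrink with
  \<open>w\<close>.\<close>

definition "chernoff_const = 4 / \<gamma>\<^sup>2 * expectation (\<lambda>\<omega>. exp (\<gamma> * X 1 \<omega>))"

lemma chernoff_const_nonneg: "chernoff_const \<ge> 0"
  by (simp add: chernoff_const_def)

lemma expectation_exp_X1_le:
  assumes "\<bar>\<theta>\<bar> \<le> \<gamma> / 2"
  shows "expectation (\<lambda>\<omega>. exp (\<theta> * X 1 \<omega>)) \<le> exp (\<theta> * \<mu> + chernoff_const * \<theta>\<^sup>2)"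
proof -
  have "\<theta> \<le> \<gamma>" using assms gamma_pos by linarith
  have "expectation (\<lambda>\<omega>. exp (\<theta> * X 1 \<omega>))
      \<le> expectation (\<lambda>\<omega>. 1 + \<theta> * X 1 \<omega> + \<theta>\<^sup>2 * (4 / \<gamma>\<^sup>2 * exp (\<gamma> * X 1 \<omega>)))"
    by (intro integral_mono integrable_exp_X1[OF \<open>\<theta> \<le> \<gamma>\<close>] exp_mult_le_quadratic
        gamma_pos assms nonneg_X Bochner_Integration.integrable_add integrable_mult_right
        integrable_X1 integrable_exp integrable_const) simp_all
  also have "\<dots> = 1 + (\<theta> * \<mu> + chernoff_const * \<theta>\<^sup>2)"
    using integrable_X1 integrable_exp by (simp add: prob_space chernoff_const_def)
  also have "\<dots> \<le> exp (\<theta> * \<mu> + chernoff_const * \<theta>\<^sup>2)" by (rule exp_ge_add_one_self)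
  finally show ?thesis .
qed

text \<open>By independence the moment generating function of the sum is a product of
  \<open>n\<close> factors, equal because the laws are. Both signs of \<theta> are covered, for use
  with both tails.\<close>

lemma exp_partial_sum:
  assumes "\<bar>\<theta>\<bar> \<le> \<gamma> / 2"
  shows "integrable M (\<lambda>\<omega>. exp (\<theta> * partial_sum X n \<omega>))"
    and "expectation (\<lambda>\<omega>. exp (\<theta> * partial_sum X n \<omega>))
          \<le> exp (real n * (\<theta> * \<mu> + chernoff_const * \<theta>\<^sup>2))"
proof -
  have "\<theta> \<le> \<gamma>" using assms gamma_pos by linarith
  have eq: "(\<lambda>\<omega>. exp (\<theta> * partial_sum X n \<omega>)) = (\<lambda>\<omega>. \<Prod>i\<in>{1..n}. exp (\<theta> * X i \<omega>))"
    by (simp add: partial_sum_def sum_distrib_left exp_sum)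
  have indep: "indep_vars (\<lambda>_. borel) (\<lambda>i \<omega>. exp (\<theta> * X i \<omega>)) {1..n}"
  proof (rule indep_vars_compose2[where X = X and Y = "\<lambda>_ y. exp (\<theta> * y)" and M' = "\<lambda>_. borel"])
    show "indep_vars (\<lambda>_. borel) X {1..n}"
      by (rule indep_vars_subset[OF iid[unfolded iid_seq_def, THEN conjunct1]]) auto
  qed measurable
  have X: "integrable M (\<lambda>\<omega>. exp (\<theta> * X i \<omega>))"
    "expectation (\<lambda>\<omega>. exp (\<theta> * X i \<omega>)) = expectation (\<lambda>\<omega>. exp (\<theta> * X 1 \<omega>))" if "i \<ge> 1" for i
  proof -
    have d: "distr M borel (X i) = distr M borel (X 1)" using iid that unfolding iid_seq_def by blast
    have f: "(\<lambda>y::real. exp (\<theta> * y)) \<in> borel_measurable borel" by measurable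
    note X1 = measurable_X[of 1, OF order_refl] and Xi = measurable_X[OF that]
    show "integrable M (\<lambda>\<omega>. exp (\<theta> * X i \<omega>))"
      using integrable_exp_X1[OF \<open>\<theta> \<le> \<gamma>\<close>]
      unfolding integrable_distr_eq[OF X1 f, symmetric] integrable_distr_eq[OF Xi f, symmetric] d .
    show "expectation (\<lambda>\<omega>. exp (\<theta> * X i \<omega>)) = expectation (\<lambda>\<omega>. exp (\<theta> * X 1 \<omega>))"
      using integral_distr[OF X1 f] integral_distr[OF Xi f] by (simp only: d)
  qed
  show "integrable M (\<lambda>\<omega>. exp (\<theta> * partial_sum X n \<omega>))"
    unfolding eq by (intro indep_vars_integrable indep) (use X(1) in auto)
  have "expectation (\<lambda>\<omega>. \<Prod>i\<in>{1..n}. exp (\<theta> * X i \<omega>))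
      = (\<Prod>i\<in>{1..n}. expectation (\<lambda>\<omega>. exp (\<theta> * X i \<omega>)))"
    by (intro indep_vars_lebesgue_integral indep) (use X(1) in auto)
  also have "\<dots> = (\<Prod>i\<in>{1..n}. expectation (\<lambda>\<omega>. exp (\<theta> * X 1 \<omega>)))"
    by (intro prod.cong X(2)) auto
  also have "\<dots> = (expectation (\<lambda>\<omega>. exp (\<theta> * X 1 \<omega>))) ^ n" by simp
  also have "\<dots> \<le> (exp (\<theta> * \<mu> + chernoff_const * \<theta>\<^sup>2)) ^ n"
    by (intro power_mono expectation_exp_X1_le assms integral_nonneg_AE) auto
  finally show "expectation (\<lambda>\<omega>. exp (\<theta> * partial_sum X n \<omega>))
          \<le> exp (real n * (\<theta> * \<mu> + chernoff_const * \<theta>\<^sup>2))"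
    unfolding eq by (simp flip: exp_of_nat_mult)
qed

lemma partial_sum_upper_tail:
  assumes "0 < \<theta>" "\<theta> \<le> \<gamma> / 2"
  shows "prob {\<omega> \<in> space M. partial_sum X n \<omega> > x}
          \<le> exp (- \<theta> * x + real n * (\<theta> * \<mu> + chernoff_const * \<theta>\<^sup>2))"
proof -
  note E = exp_partial_sum[of \<theta> n]
  have "prob {\<omega> \<in> space M. partial_sum X n \<omega> > x} \<le> prob {\<omega> \<in> space M. partial_sum X n \<omega> \<ge> x}"
    by (intro finite_measure_mono) auto
  also have "\<dots> \<le> exp (- \<theta> * x) * (\<integral>\<omega>\<in>space M. exp (\<theta> * partial_sum X n \<omega>) \<partial>M)"
    by (intro Chernoff_ineq_ge) (use E assms in \<open>auto simp: set_integrable_def cong: Bochner_Integration.integrable_cong\<close>)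
  also have "(\<integral>\<omega>\<in>space M. exp (\<theta> * partial_sum X n \<omega>) \<partial>M)
      \<le> exp (real n * (\<theta> * \<mu> + chernoff_const * \<theta>\<^sup>2))"
    using E assms by (simp add: set_integral_space)
  finally show ?thesis by (simp add: exp_diff exp_minus field_simps)
qed

text \<open>Markov's inequality for the exponential of the sum with negative parameter
  \<open>- \<theta>\<close>.\<close>

lemma partial_sum_lower_tail:
  assumes "0 < \<theta>" "\<theta> \<le> \<gamma> / 2"
  shows "prob {\<omega> \<in> space M. partial_sum X n \<omega> \<le> x}
          \<le> exp (\<theta> * x + real n * (chernoff_const * \<theta>\<^sup>2 - \<theta> * \<mu>))"
proof -
  note E = exp_partial_sum[of "- \<theta>" n]
  have "prob {\<omega> \<in> space M. partial_sum X n \<omega> \<le> x}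
      \<le> exp (\<theta> * x) * (\<integral>\<omega>\<in>space M. exp (- \<theta> * partial_sum X n \<omega>) \<partial>M)"
    by (intro Chernoff_ineq_le) (use E assms in \<open>auto simp: set_integrable_def cong: Bochner_Integration.integrable_cong\<close>)
  also have "(\<integral>\<omega>\<in>space M. exp (- \<theta> * partial_sum X n \<omega>) \<partial>M)
      \<le> exp (real n * (chernoff_const * \<theta>\<^sup>2 - \<theta> * \<mu>))"
    using E assms by (simp add: set_integral_space)
  finally show ?thesis by (simp add: exp_add)
qed

end


section \<open>Decomposing the random sum according to the value of \<open>N\<close>\<close>

locale random_sum = light_tailed_walk +
  fixes N :: "'a \<Rightarrow> nat"
  assumes measurable_N [measurable]: "N \<in> measurable M (count_space UNIV)"
    and indep_N: "indep_of_seq M N X"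
begin

abbreviation "tail_N \<equiv> tail_prob M (\<lambda>\<omega>. real (N \<omega>))"

abbreviation "tail_sum \<equiv> tail_prob M (\<lambda>\<omega>. partial_sum X (N \<omega>) \<omega>)"

lemma measurable_random_sum [measurable]: "(\<lambda>\<omega>. partial_sum X (N \<omega>) \<omega>) \<in> borel_measurable M"
  by (rule measurable_compose_countable[of "partial_sum X"]) measurable

lemma antimono_tail_N: "antimono tail_N"
  by (intro antimonoI) (auto simp: tail_prob_def intro!: finite_measure_mono)

lemma tail_N_le_1: "tail_N x \<le> 1"
  by (simp add: tail_prob_def)

lemma prob_N_partial_sum:
  assumes B: "B \<in> sets borel"
  shows "prob {\<omega> \<in> space M. N \<omega> \<in> A \<and> partial_sum X n \<omega> \<in> B}
      = prob {\<omega> \<in> space M. N \<omega> \<in> A} * prob {\<omega> \<in> space M. partial_sum X n \<omega> \<in> B}"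
proof -
  let ?P = "\<Pi>\<^sub>M i\<in>{1::nat..}. (borel :: real measure)"
  let ?f = "\<lambda>\<omega>. \<lambda>i\<in>{1..}. X i \<omega>"
  have [measurable]: "(\<lambda>f. \<Sum>i=1..n. f i) \<in> borel_measurable ?P"
    by (intro borel_measurable_sum measurable_component_singleton) auto
  \<comment> \<open>The sequences whose first \<open>n\<close> entries have their sum in
    \<open>B\<close>: the event on the partial sum is the preimage of this measurable set under the
    whole sequence, to which the independence hypothesis applies.\<close>
  let ?B = "(\<lambda>f. \<Sum>i=1..n. f i) -` B \<inter> space ?P"
  have "?B \<in> sets ?P" using B by measurable
  then have "?f -` ?B \<inter> space M \<in> sets (vimage_algebra (space M) ?f ?P)"
    by (rule in_vimage_algebra)
  moreover have "N -` A \<inter> space M \<in> sets (vimage_algebra (space M) N (count_space UNIV))"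
    by (rule in_vimage_algebra) simp
  ultimately have "prob ((N -` A \<inter> space M) \<inter> (?f -` ?B \<inter> space M))
      = prob (N -` A \<inter> space M) * prob (?f -` ?B \<inter> space M)"
    using indep_N unfolding indep_of_seq_def by (intro indep_setD)
  moreover have "?f -` ?B \<inter> space M = {\<omega> \<in> space M. partial_sum X n \<omega> \<in> B}"
    by (auto simp: space_PiM partial_sum_def)
  moreover have "(N -` A \<inter> space M) \<inter> {\<omega> \<in> space M. partial_sum X n \<omega> \<in> B}
      = {\<omega> \<in> space M. N \<omega> \<in> A \<and> partial_sum X n \<omega> \<in> B}"
    "N -` A \<inter> space M = {\<omega> \<in> space M. N \<omega> \<in> A}" by auto
  ultimately show ?thesis by (simp only:)
qed

text \<open>Either \<open>N\<close> exceeds \<open>t\<close>, or it takes one of finitely many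
  values \<open>n\<close> up to \<open>t\<close>; a union bound over these values and independence
  give the sum.\<close>

lemma tail_sum_le:
  "tail_sum x \<le> tail_N t + (\<Sum>n | real n \<le> t.
     prob {\<omega> \<in> space M. N \<omega> = n} * prob {\<omega> \<in> space M. partial_sum X n \<omega> > x})"
proof -
  let ?E = "\<lambda>n. {\<omega> \<in> space M. N \<omega> = n \<and> partial_sum X n \<omega> > x}"
  have "{n. real n \<le> t} \<subseteq> {..nat \<lfloor>t\<rfloor>}" by (auto simp: le_nat_floor)
  then have fin: "finite {n. real n \<le> t}" by (rule finite_subset) simp
  have "tail_sum x \<le> prob ({\<omega> \<in> space M. real (N \<omega>) > t} \<union> (\<Union>n\<in>{n. real n \<le> t}. ?E n))"
    unfolding tail_prob_def by (intro finite_measure_mono sets.Un sets.finite_UN fin) auto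
  also have "\<dots> \<le> tail_N t + prob (\<Union>n\<in>{n. real n \<le> t}. ?E n)"
    unfolding tail_prob_def by (intro measure_Un_le sets.finite_UN fin) auto
  also have "prob (\<Union>n\<in>{n. real n \<le> t}. ?E n) \<le> (\<Sum>n | real n \<le> t. prob (?E n))"
    by (intro finite_measure_subadditive_finite fin) auto
  also have "\<dots> = (\<Sum>n | real n \<le> t.
      prob {\<omega> \<in> space M. N \<omega> = n} * prob {\<omega> \<in> space M. partial_sum X n \<omega> > x})"
    using prob_N_partial_sum[of "{x<..}" "{_}"] by (intro sum.cong) simp_all
  finally show ?thesis by simp
qed

text \<open>Here \<open>m\<close> is the least natural number above \<open>t\<close>. When
  \<open>N\<close> is at least \<open>m\<close>, nonnegativity of the summands makes the random sum
  at least \<open>partial_sum X m\<close>, a single sum independent of \<open>N\<close>.\<close>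

lemma tail_sum_ge:
  assumes "t \<ge> 0" and m: "m = Suc (nat \<lfloor>t\<rfloor>)"
  shows "tail_sum x \<ge> tail_N t * prob {\<omega> \<in> space M. partial_sum X m \<omega> > x}"
proof -
  have iff: "real n > t \<longleftrightarrow> n \<in> {m..}" for n
    using assms by (auto simp: Suc_le_eq) linarith+
  have "tail_N t * prob {\<omega> \<in> space M. partial_sum X m \<omega> > x}
      = prob {\<omega> \<in> space M. N \<omega> \<in> {m..} \<and> partial_sum X m \<omega> \<in> {x<..}}"
    unfolding tail_prob_def iff using prob_N_partial_sum[of "{x<..}" "{m..}" m] by simp
  also have "\<dots> \<le> tail_sum x"
    unfolding tail_prob_def
    by (intro finite_measure_mono) (auto intro: less_le_trans partial_sum_mono)
  finally show ?thesis .
qed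

section \<open>Chernoff bounds on the square-root scale\<close>

text \<open>With \<theta> = 1 / sqrt w the quadratic term becomes
  \<open>chernoff_const * (n / w)\<close>, bounded because \<open>n\<close> is at most
  \<open>w\<close>, and the linear term measures the deviation in units of
  \<open>sqrt w\<close>.\<close>

lemma partial_sum_upper_tail_sqrt:
  assumes "w > 0" "1 / sqrt w \<le> \<gamma> / 2" "real n \<le> w"
  shows "prob {\<omega> \<in> space M. partial_sum X n \<omega> > \<mu> * w}
      \<le> exp (chernoff_const - \<mu> * (w - real n) / sqrt w)"
proof -
  have "prob {\<omega> \<in> space M. partial_sum X n \<omega> > \<mu> * w}
      \<le> exp (- (1 / sqrt w) * (\<mu> * w)
          + real n * (1 / sqrt w * \<mu> + chernoff_const * (1 / sqrt w)\<^sup>2))"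
    using assms by (intro partial_sum_upper_tail) auto
  also have "- (1 / sqrt w) * (\<mu> * w) + real n * (1 / sqrt w * \<mu> + chernoff_const * (1 / sqrt w)\<^sup>2)
      = chernoff_const * (real n / w) - \<mu> * (w - real n) / sqrt w"
  proof -
    have "w = (sqrt w)\<^sup>2" "sqrt w > 0" using assms by auto
    then obtain s where "w = s\<^sup>2" "s > 0" by blast
    then show ?thesis by (simp add: field_simps power2_eq_square)
  qed
  also have "chernoff_const * (real n / w) \<le> chernoff_const * 1"
    using assms by (intro mult_left_mono chernoff_const_nonneg) auto
  finally show ?thesis by simp
qed

text \<open>As \<open>n\<close> is not bounded above, the quadratic term exceeds
  \<open>chernoff_const\<close> by \<open>chernoff_const * (n - w) / w\<close>. For large
  \<open>w\<close> this consumes at most half of the linear term, hence the rate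
  \<open>\<mu> / 2\<close>.\<close>

lemma partial_sum_lower_tail_sqrt:
  assumes "w > 0" "1 / sqrt w \<le> \<gamma> / 2" "chernoff_const / sqrt w \<le> \<mu> / 2" "real n \<ge> w"
  shows "prob {\<omega> \<in> space M. partial_sum X n \<omega> \<le> \<mu> * w}
      \<le> exp (chernoff_const - \<mu> / 2 * (real n - w) / sqrt w)"
proof -
  have "prob {\<omega> \<in> space M. partial_sum X n \<omega> \<le> \<mu> * w}
      \<le> exp (1 / sqrt w * (\<mu> * w)
          + real n * (chernoff_const * (1 / sqrt w)\<^sup>2 - 1 / sqrt w * \<mu>))"
    using assms by (intro partial_sum_lower_tail) auto
  also have "1 / sqrt w * (\<mu> * w) + real n * (chernoff_const * (1 / sqrt w)\<^sup>2 - 1 / sqrt w * \<mu>)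
      = chernoff_const - \<mu> * (real n - w) / sqrt w + chernoff_const * (real n - w) / w"
  proof -
    have "w = (sqrt w)\<^sup>2" "sqrt w > 0" using assms by auto
    then obtain s where "w = s\<^sup>2" "s > 0" by blast
    then show ?thesis by (simp add: field_simps power2_eq_square)
  qed
  also have "chernoff_const * (real n - w) / w = (chernoff_const / sqrt w) * ((real n - w) / sqrt w)"
    using assms by simp
  also have "\<dots> \<le> (\<mu> / 2) * ((real n - w) / sqrt w)"
    using assms by (intro mult_right_mono) auto
  finally show ?thesis by (simp add: field_simps)
qed

end

section \<open>Consequences of polynomial growth\<close>

text \<open>The factor \<open>x + 1\<close> will bound the number of summands in the upper
  estimate.\<close>

lemma superpolynomial_decay:
  assumes a: "\<forall>\<^sub>F x in at_top. x powr \<delta> \<le> f x" and "\<delta> > 0" "k > 0"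
  shows "((\<lambda>x. (x + 1) * exp (- k * f x)) \<longlongrightarrow> (0::real)) at_top"
proof (rule tendsto_sandwich)
  show "\<forall>\<^sub>F x in at_top. 0 \<le> (x + 1) * exp (- k * f x)"
    using eventually_ge_at_top[of 0] by eventually_elim simp
  show "\<forall>\<^sub>F x in at_top. (x + 1) * exp (- k * f x) \<le> (x + 1) * exp (- k * x powr \<delta>)"
    using a eventually_ge_at_top[of 0]
    by eventually_elim (use \<open>k > 0\<close> in \<open>auto intro!: mult_left_mono\<close>)
  show "((\<lambda>x. (x + 1) * exp (- k * x powr \<delta>)) \<longlongrightarrow> 0) at_top"
    using assms(2,3) by real_asymp
qed auto

text \<open>The strict inequality leaves room for an exponent \<open>c\<close> strictly between
  \<open>b\<close> and the lower limit; for x > 1 the logarithm is positive, so one can multiply by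
  it and exponentiate.\<close>

lemma Liminf_log_ratio_imp_powr_le:
  fixes a :: "real \<Rightarrow> real"
  assumes "\<forall>\<^sub>F x in at_top. a x > 0" and "Liminf at_top (\<lambda>x. ereal (ln (a x) / ln x)) > ereal b"
  obtains c where "c > b" "\<forall>\<^sub>F x in at_top. x powr c \<le> a x"
proof -
  obtain c where c: "b < c" "ereal c < Liminf at_top (\<lambda>x. ereal (ln (a x) / ln x))"
    using ereal_dense2[OF assms(2)] by auto
  from less_LiminfD[OF c(2)] have "\<forall>\<^sub>F x in at_top. c < ln (a x) / ln x" by simp
  with assms(1) eventually_gt_at_top[of 1] have "\<forall>\<^sub>F x in at_top. x powr c \<le> a x"
  proof eventually_elim
    case (elim x)
    then have "c * ln x \<le> ln (a x)" by (simp add: field_simps)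
    then have "exp (c * ln x) \<le> exp (ln (a x))" by simp
    then show ?case using elim by (simp add: powr_def)
  qed
  with c(1) show thesis by (rule that)
qed

section \<open>Two-sided estimate of the ratio of tails\<close>

theorem (in random_sum) tail_sum_asymp_equiv:
  assumes "\<mu> > 0" and mda: "gumbel_mda M (\<lambda>\<omega>. real (N \<omega>)) a"
    and Liminf: "Liminf at_top (\<lambda>x. ereal (ln (a x) / ln x)) > ereal (1 / 2)"
  shows "tail_sum \<sim>[at_top] (\<lambda>x. tail_N (x / \<mu>))"
proof -
  have a_pos: "\<forall>\<^sub>F x in at_top. a x > 0" and G_pos: "\<And>x. tail_N x > 0"
    and G_lim: "\<And>y. ((\<lambda>x. tail_N (x + y * a x) / tail_N x) \<longlongrightarrow> exp (- y)) at_top"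
    using mda by (auto simp: gumbel_mda_def)
  obtain b where b: "b > 1 / 2" "\<forall>\<^sub>F x in at_top. x powr b \<le> a x"
    using Liminf_log_ratio_imp_powr_le[OF a_pos Liminf] by auto
  \<comment> \<open>The surplus of the exponent over 1/2, which survives division by
    \<open>sqrt x\<close> in \<open>A\<close>.\<close>
  define \<delta> where "\<delta> = b - 1 / 2"
  have "\<delta> > 0" using b(1) by (simp add: \<delta>_def)
  define A where "A x = a x / sqrt x" for x
  have A_ge: "\<forall>\<^sub>F x in at_top. x powr \<delta> \<le> A x"
    using b(2) eventually_gt_at_top[of 0]
    by eventually_elim (simp add: A_def \<delta>_def powr_diff powr_half_sqrt divide_right_mono)
  have A_lim: "filterlim A at_top at_top"
  proof (rule filterlim_at_top_mono[OF _ A_ge])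
    show "filterlim (\<lambda>x. x powr \<delta>) at_top at_top" using \<open>\<delta> > 0\<close> by real_asymp
  qed
  \<comment> \<open>Half of the upper Chernoff rate \<mu>: growth of the tail of \<open>N\<close>
    uses \<open>c\<close>, and \<mu> - c = c is left for decay.\<close>
  define c where "c = \<mu> / 2"
  have "c > 0" using \<open>\<mu> > 0\<close> by (simp add: c_def)
  have "((\<lambda>x. tail_N (x + a x) / tail_N x) \<longlongrightarrow> exp (- 1)) at_top" using G_lim[of 1] by simp
  from tail_ratio_bound[OF antimono_tail_N G_pos tail_N_le_1 this A_lim[unfolded A_def[abs_def]] \<open>c > 0\<close>]
  obtain K where "K > 0" and K: "\<And>z w. 0 < w \<Longrightarrow> z \<le> w \<Longrightarrow>
      tail_N z \<le> K * exp (c * (w - z) / sqrt w) * tail_N w"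
    by blast
  define R where "R w = tail_sum (\<mu> * w) / tail_N w" for w
  have ev_gamma: "\<forall>\<^sub>F w in at_top. 1 / sqrt w \<le> \<gamma> / 2"
    using gamma_pos by real_asymp
  have ev_mu: "\<forall>\<^sub>F w in at_top. chernoff_const / sqrt w \<le> \<mu> / 2"
  proof -
    have "((\<lambda>w. chernoff_const / sqrt w) \<longlongrightarrow> 0) at_top"
      by (intro tendsto_divide_0[OF tendsto_const] filterlim_at_top_imp_at_infinity sqrt_at_top)
    from order_tendstoD(2)[OF this, of "\<mu> / 2"] \<open>\<mu> > 0\<close> show ?thesis
      by (auto elim: eventually_mono)
  qed
  \<comment> \<open>The first summand comes from \<open>N\<close> above w - \<epsilon> * a w, the
    second from the smaller values of \<open>N\<close>, for which the sum must be atypically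
    large.\<close>
  have upper: "\<forall>\<^sub>F w in at_top. R w \<le> tail_N (w + (- \<epsilon>) * a w) / tail_N w
      + K * exp (chernoff_const + c) * ((w + 1) * exp (- (c * \<epsilon>) * A w))" if "\<epsilon> > 0" for \<epsilon>
    using ev_gamma a_pos eventually_ge_at_top[of 1]
  proof eventually_elim
    case (elim w)
    define t where "t = w - \<epsilon> * a w"
    have "t \<le> w" using elim that by (simp add: t_def)
    let ?L = "K * exp (chernoff_const + c) * exp (- (c * \<epsilon>) * A w) * tail_N w"
    have "?L \<ge> 0" using \<open>K > 0\<close> G_pos[of w] by simp
    have term_le: "prob {\<omega> \<in> space M. N \<omega> = n} * prob {\<omega> \<in> space M. partial_sum X n \<omega> > \<mu> * w} \<le> ?L"
      if n: "real n \<le> t" for n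
    proof -
      \<comment> \<open>A point mass is bounded by the tail one unit to its left. The shift costs
        \<open>exp (c / sqrt w)\<close>, at most \<open>exp c\<close> as w >= 1; for n = 0 the bound
        \<open>K\<close> is used at the argument -1.\<close>
      have "prob {\<omega> \<in> space M. N \<omega> = n} \<le> tail_N (real n - 1)"
        unfolding tail_prob_def by (intro finite_measure_mono) auto
      also have "\<dots> \<le> K * exp (c * (w - (real n - 1)) / sqrt w) * tail_N w"
        by (rule K) (use elim n \<open>t \<le> w\<close> in auto)
      finally have "prob {\<omega> \<in> space M. N \<omega> = n} * prob {\<omega> \<in> space M. partial_sum X n \<omega> > \<mu> * w}
          \<le> (K * exp (c * (w - (real n - 1)) / sqrt w) * tail_N w)
            * exp (chernoff_const - \<mu> * (w - real n) / sqrt w)"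
        by (rule mult_mono[OF _ partial_sum_upper_tail_sqrt])
          (use elim n \<open>t \<le> w\<close> \<open>K > 0\<close> G_pos[of w] in auto)
      also have "\<dots> = K * tail_N w * exp (c * (w - (real n - 1)) / sqrt w
          + (chernoff_const - \<mu> * (w - real n) / sqrt w))"
        unfolding exp_add by simp
      also have "c * (w - (real n - 1)) / sqrt w + (chernoff_const - \<mu> * (w - real n) / sqrt w)
          = chernoff_const + c / sqrt w - c * (w - real n) / sqrt w"
        by (simp add: c_def add_divide_distrib diff_divide_distrib algebra_simps)
      also have "K * tail_N w * exp \<dots> \<le> K * tail_N w * exp (chernoff_const + c - c * \<epsilon> * A w)"
      proof -
        have "c / sqrt w \<le> c / 1" using elim \<open>c > 0\<close> by (intro divide_left_mono) auto
        moreover have "c * (\<epsilon> * a w) / sqrt w \<le> c * (w - real n) / sqrt w"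
          using n \<open>c > 0\<close> elim by (intro divide_right_mono mult_left_mono) (auto simp: t_def)
        ultimately have "chernoff_const + c / sqrt w - c * (w - real n) / sqrt w
            \<le> chernoff_const + c - c * \<epsilon> * A w" by (simp add: A_def)
        then show ?thesis using \<open>K > 0\<close> G_pos[of w] by simp
      qed
      also have "\<dots> = ?L" by (simp add: exp_diff exp_minus field_simps)
      finally show ?thesis .
    qed
    have sub: "{n. real n \<le> t} \<subseteq> {..nat \<lfloor>w\<rfloor>}" using \<open>t \<le> w\<close> by (auto simp: le_nat_floor)
    have "card {n. real n \<le> t} \<le> card {..nat \<lfloor>w\<rfloor>}" by (rule card_mono) (use sub in auto)
    then have "card {n. real n \<le> t} \<le> Suc (nat \<lfloor>w\<rfloor>)" by simp
    then have card: "real (card {n. real n \<le> t}) \<le> w + 1" using elim by linarith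
    have "tail_sum (\<mu> * w) \<le> tail_N t + (\<Sum>n | real n \<le> t.
        prob {\<omega> \<in> space M. N \<omega> = n} * prob {\<omega> \<in> space M. partial_sum X n \<omega> > \<mu> * w})"
      by (rule tail_sum_le)
    also have "(\<Sum>n | real n \<le> t.
        prob {\<omega> \<in> space M. N \<omega> = n} * prob {\<omega> \<in> space M. partial_sum X n \<omega> > \<mu> * w})
        \<le> real (card {n. real n \<le> t}) * ?L"
      by (rule sum_bounded_above) (use term_le in auto)
    also have "\<dots> \<le> (w + 1) * ?L" using card \<open>?L \<ge> 0\<close> by (rule mult_right_mono)
    finally have "R w \<le> (tail_N t + (w + 1) * ?L) / tail_N w"
      unfolding R_def using G_pos[of w] by (simp add: divide_right_mono)
    also have "(tail_N t + (w + 1) * ?L) / tail_N w = tail_N t / tail_N w + (w + 1) * ?L / tail_N w"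
      by (rule add_divide_distrib)
    also have "(w + 1) * ?L / tail_N w = K * exp (chernoff_const + c) * ((w + 1) * exp (- (c * \<epsilon>) * A w))"
      using G_pos[of w] by simp
    finally show ?case by (simp add: t_def)
  qed
  \<comment> \<open>With \<open>m\<close> terms just beyond w + \<epsilon> * a w, the mean of the
    sum exceeds \<mu> * w by at least \<mu> * \<epsilon> * a w, so staying below \<mu> * w has
    probability exponentially small in \<open>A w\<close>.\<close>
  have lower: "\<forall>\<^sub>F w in at_top. tail_N (w + \<epsilon> * a w) / tail_N w
      * (1 - exp (chernoff_const - c * \<epsilon> * A w)) \<le> R w" if "\<epsilon> > 0" for \<epsilon>
    using ev_gamma ev_mu a_pos eventually_ge_at_top[of 1]
  proof eventually_elim
    case (elim w)
    define t where "t = w + \<epsilon> * a w"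
    define m where "m = Suc (nat \<lfloor>t\<rfloor>)"
    have "t \<ge> w" using elim that by (simp add: t_def)
    then have m: "real m \<ge> t" "t \<ge> 0" using elim by (auto simp: m_def) linarith
    have "prob {\<omega> \<in> space M. partial_sum X m \<omega> \<le> \<mu> * w}
        \<le> exp (chernoff_const - \<mu> / 2 * (real m - w) / sqrt w)"
      by (rule partial_sum_lower_tail_sqrt) (use elim m \<open>t \<ge> w\<close> in auto)
    also have "\<dots> \<le> exp (chernoff_const - c * \<epsilon> * A w)"
    proof -
      have "c * (\<epsilon> * a w) / sqrt w \<le> c * (real m - w) / sqrt w"
        using m \<open>c > 0\<close> elim by (intro divide_right_mono mult_left_mono) (auto simp: t_def)
      then show ?thesis by (simp add: A_def c_def)
    qed
    finally have "1 - exp (chernoff_const - c * \<epsilon> * A w)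
        \<le> 1 - prob {\<omega> \<in> space M. partial_sum X m \<omega> \<le> \<mu> * w}" by simp
    also have "\<dots> = prob {\<omega> \<in> space M. partial_sum X m \<omega> > \<mu> * w}"
      by (subst prob_neg[symmetric]) (auto simp: not_le)
    finally have "tail_N t * (1 - exp (chernoff_const - c * \<epsilon> * A w))
        \<le> tail_N t * prob {\<omega> \<in> space M. partial_sum X m \<omega> > \<mu> * w}"
      using G_pos[of t] by simp
    also have "\<dots> \<le> tail_sum (\<mu> * w)" using m(2) m_def by (rule tail_sum_ge)
    finally show ?case using G_pos[of w] by (simp add: R_def t_def divide_right_mono)
  qed
  have upper_lim: "((\<lambda>w. tail_N (w + (- \<epsilon>) * a w) / tail_N w
      + K * exp (chernoff_const + c) * ((w + 1) * exp (- (c * \<epsilon>) * A w))) \<longlongrightarrow> exp \<epsilon>) at_top"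
    if "\<epsilon> > 0" for \<epsilon>
  proof -
    have "((\<lambda>w. (w + 1) * exp (- (c * \<epsilon>) * A w)) \<longlongrightarrow> 0) at_top"
      using that \<open>c > 0\<close> by (intro superpolynomial_decay[OF A_ge \<open>\<delta> > 0\<close>]) simp
    from tendsto_add[OF G_lim[of "- \<epsilon>"] tendsto_mult_left[OF this]] show ?thesis by simp
  qed
  have lower_lim: "((\<lambda>w. tail_N (w + \<epsilon> * a w) / tail_N w
      * (1 - exp (chernoff_const - c * \<epsilon> * A w))) \<longlongrightarrow> exp (- \<epsilon>)) at_top"
    if "\<epsilon> > 0" for \<epsilon>
  proof -
    have "filterlim (\<lambda>w. - chernoff_const + c * \<epsilon> * A w) at_top at_top"
      using that \<open>c > 0\<close>
      by (intro filterlim_tendsto_add_at_top[OF tendsto_const]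
          filterlim_tendsto_pos_mult_at_top[OF tendsto_const _ A_lim]) simp
    then have "filterlim (\<lambda>w. chernoff_const - c * \<epsilon> * A w) at_bot at_top"
      by (simp add: filterlim_uminus_at_bot)
    from filterlim_compose[OF exp_at_bot this]
    have "((\<lambda>w. 1 - exp (chernoff_const - c * \<epsilon> * A w)) \<longlongrightarrow> 1 - 0) at_top"
      by (intro tendsto_diff tendsto_const)
    from tendsto_mult[OF G_lim[of \<epsilon>] this] show ?thesis by simp
  qed
  have "(R \<longlongrightarrow> 1) at_top"
  proof (rule order_tendstoI)
    fix y :: real assume "y < 1"
    \<comment> \<open>Then exp (- \<epsilon>) >= 1 - \<epsilon> = (1 + y) / 2 > y.\<close>
    define \<epsilon> where "\<epsilon> = (1 - y) / 2"
    have "\<epsilon> > 0" using \<open>y < 1\<close> by (simp add: \<epsilon>_def)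
    have "y < exp (- \<epsilon>)"
      using exp_ge_add_one_self[of "- \<epsilon>"] \<open>y < 1\<close> by (simp add: \<epsilon>_def field_simps)
    from order_tendstoD(1)[OF lower_lim[OF \<open>\<epsilon> > 0\<close>] this] lower[OF \<open>\<epsilon> > 0\<close>]
    show "\<forall>\<^sub>F w in at_top. y < R w" by eventually_elim linarith
  next
    fix y :: real assume "y > 1"
    define \<epsilon> where "\<epsilon> = ln y / 2"
    have "\<epsilon> > 0" using \<open>y > 1\<close> by (simp add: \<epsilon>_def)
    then have "\<epsilon> < ln y" by (simp add: \<epsilon>_def)
    then have "exp \<epsilon> < y" using \<open>y > 1\<close> by (metis exp_less_mono exp_ln less_trans zero_less_one)
    from order_tendstoD(2)[OF upper_lim[OF \<open>\<epsilon> > 0\<close>] this] upper[OF \<open>\<epsilon> > 0\<close>]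
    show "\<forall>\<^sub>F w in at_top. R w < y" by eventually_elim linarith
  qed
  \<comment> \<open>Substituting w = x / \<mu> turns the limit of \<open>R\<close> into the ratio of
    the two tails at \<open>x\<close>.\<close>
  moreover have "filterlim (\<lambda>x. x / \<mu>) at_top at_top"
    using \<open>\<mu> > 0\<close> filterlim_tendsto_pos_mult_at_top[OF tendsto_const _ filterlim_ident, of "1 / \<mu>"]
    by simp
  ultimately have "((\<lambda>x. R (x / \<mu>)) \<longlongrightarrow> 1) at_top" by (rule filterlim_compose)
  then show ?thesis using \<open>\<mu> > 0\<close> by (intro asymp_equivI') (simp add: R_def)
qed

theorem theorem4p2:
  fixes M :: "'a measure"
    and N :: "'a \<Rightarrow> nat"
    and X :: "nat \<Rightarrow> 'a \<Rightarrow> real"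
    and \<mu> \<gamma> :: real
    and a :: "real \<Rightarrow> real"
  assumes "prob_space M"
    and "N \<in> measurable M (count_space UNIV)"
    and "\<And>i. i \<ge> 1 \<Longrightarrow> X i \<in> borel_measurable M"
    and "\<And>i \<omega>. i \<ge> 1 \<Longrightarrow> \<omega> \<in> space M \<Longrightarrow> X i \<omega> \<ge> 0"
    and "iid_seq M X"
    and "\<mu> = (LINT \<omega>|M. X 1 \<omega>)"
    and "\<mu> > 0"
    and "indep_of_seq M N X"
    and "\<gamma> > 0"
    and "integrable M (\<lambda>\<omega>. exp (\<gamma> * X 1 \<omega>))"
    and "gumbel_mda M (\<lambda>\<omega>. real (N \<omega>)) a"
    and "Liminf at_top (\<lambda>x. ereal (ln (a x) / ln x)) > ereal (1 / 2)"
  shows "(\<lambda>x. tail_prob M (\<lambda>\<omega>. partial_sum X (N \<omega>) \<omega>) x)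
           \<sim>[at_top] (\<lambda>x. tail_prob M (\<lambda>\<omega>. real (N \<omega>)) (x / \<mu>))"
proof -
  interpret random_sum M X \<gamma> N
    by (intro random_sum.intro light_tailed_walk.intro light_tailed_walk_axioms.intro
        random_sum_axioms.intro) (fact assms)+
  show ?thesis
    using tail_sum_asymp_equiv[of a] assms(6,7,11,12) by simp
qed

end
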